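(* Let $\mathbb{X}$ be a set with a symmetric neighbouring relation $\simeq$, and let $f : \mathbb{X} \to \mathbb{R}^d$ be a function with global $L_2$ sensitivity $\Delta = \sup_{x \simeq x'} \|f(x) - f(x')\|$, where $0 < \Delta < \infty$. Let $\sigma > 0$. For any $\varepsilon \geq 0$ and $\delta \in [0,1]$, the Gaussian output perturbation mechanism $M(x) = f(x) + Z$ with $Z \sim \mathcal{N}(0,\sigma^2 I)$ is $(\varepsilon,\delta)$-DP if and only if $$\Phi\left(\frac{\Delta}{2 \sigma} - \frac{\varepsilon \sigma}{\Delta}\right) - e^{\varepsilon}\, \Phi\left(- \frac{\Delta}{2 \sigma} - \frac{\varepsilon \sigma}{\Delta}\right) \leq \delta .$$
   Context: $\|\cdot\|$ is the Euclidean norm on $\mathbb{R}^d$, and $I$ is the $d\times d$ identity matrix. A randomized algorithm $M : \mathbb{X} \to \mathbb{Y}$ (each $M(x)$ is a $\mathbb{Y}$-valued random variable) is $(\varepsilon,\delta)$-DP (differentially private), for $\varepsilon \ge 0$ and $\delta\in[0,1]$, if for every pair of neighbouring inputs $x \simeq x'$ and every measurable set $E \subseteq \mathbb{Y}$ one has $\mathbb{P}[M(x) \in E] \leq e^{\varepsilon}\, \mathbb{P}[M(x') \in E] + \delta$. $\Phi(t) = \mathbb{P}[\mathcal{N}(0,1) \leq t] = \frac{1}{\sqrt{2\pi}}\int_{-\infty}^t e^{-y^2/2}\,dy$ is the standard Gaussian CDF. *)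

theory Defs
  imports "HOL-Probability.Probability"
begin

definition neighbour_pairs :: "'x set \<Rightarrow> ('x \<Rightarrow> 'x \<Rightarrow> bool) \<Rightarrow> ('x \<times> 'x) set" where
  "neighbour_pairs X nb = {(x, x'). x \<in> X \<and> x' \<in> X \<and> nb x x'}"

text \<open>
  A randomized algorithm with inputs in \<open>X\<close> and outputs in the measurable space \<open>Y\<close> is a family
  of \<open>Y\<close>-valued random variables \<open>M x\<close>, \<open>x \<in> X\<close>, on a probability space \<open>P\<close>.
  Only the laws of the individual \<open>M x\<close> matter below, so a common \<open>P\<close> loses no generality.
\<close>

definition randomized_algorithm ::
    "'w measure \<Rightarrow> 'x set \<Rightarrow> 'y measure \<Rightarrow> ('x \<Rightarrow> 'w \<Rightarrow> 'y) \<Rightarrow> bool" where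
  "randomized_algorithm P X Y M \<longleftrightarrow> prob_space P \<and> (\<forall>x\<in>X. M x \<in> measurable P Y)"

definition differentially_private ::
    "'w measure \<Rightarrow> 'x set \<Rightarrow> ('x \<Rightarrow> 'x \<Rightarrow> bool) \<Rightarrow> 'y measure \<Rightarrow> real \<Rightarrow> real \<Rightarrow>
      ('x \<Rightarrow> 'w \<Rightarrow> 'y) \<Rightarrow> bool" where
  "differentially_private P X nb Y \<epsilon> \<delta> M \<longleftrightarrow>
     randomized_algorithm P X Y M \<and>
     (\<forall>(x, x') \<in> neighbour_pairs X nb. \<forall>E \<in> sets Y.
        measure P {\<omega> \<in> space P. M x \<omega> \<in> E}
          \<le> exp \<epsilon> * measure P {\<omega> \<in> space P. M x' \<omega> \<in> E} + \<delta>)"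

text \<open>The supremum is taken in \<open>[0, \<infinity>]\<close>, so that it is meaningful when the distances are unbounded.\<close>

definition L2_sensitivity ::
    "'x set \<Rightarrow> ('x \<Rightarrow> 'x \<Rightarrow> bool) \<Rightarrow> ('x \<Rightarrow> real ^ 'd) \<Rightarrow> ennreal" where
  "L2_sensitivity X nb f = (SUP (x, x') \<in> neighbour_pairs X nb. ennreal (norm (f x - f x')))"

text \<open>Lebesgue density of the normal law on \<open>\<real>\<^sup>d\<close> with mean \<open>0\<close> and covariance \<open>\<sigma>\<^sup>2 I\<close>.\<close>

definition isotropic_normal_density :: "real \<Rightarrow> real ^ 'd \<Rightarrow> real" where
  "isotropic_normal_density \<sigma> z =
     1 / sqrt (2 * pi * \<sigma>\<^sup>2) ^ CARD('d) * exp (- (norm z)\<^sup>2 / (2 * \<sigma>\<^sup>2))"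

definition std_normal_cdf :: "real \<Rightarrow> real" where
  "std_normal_cdf = cdf (density lborel (\<lambda>y. ennreal (std_normal_density y)))"

end

theory Submission
  imports Defs
begin

text \<open>
  For two inputs whose images under \<open>f\<close> lie at distance \<open>s > 0\<close>, the event \<open>E\<close> maximising
  \<open>P[M x \<in> E] - exp \<epsilon> P[M x' \<in> E]\<close> is, by the Neyman--Pearson argument, the set where the
  density of \<open>M x\<close> is at least \<open>exp \<epsilon>\<close> times that of \<open>M x'\<close>. For isotropic Gaussians this is
  a half-space orthogonal to \<open>f x' - f x\<close>, so its probabilities are values of the
  one-dimensional normal distribution function, and the maximum is
  \<open>G s = \<Phi> (s / (2 \<sigma>) - \<epsilon> \<sigma> / s) - exp \<epsilon> \<Phi> (- s / (2 \<sigma>) - \<epsilon> \<sigma> / s)\<close>.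
  As \<open>G\<close> is increasing and continuous, \<open>G s \<le> \<delta>\<close> for all occurring distances \<open>s\<close> is
  equivalent to \<open>G \<Delta> \<le> \<delta>\<close>, whether or not the supremum \<open>\<Delta>\<close> is attained.
\<close>

section \<open>The one-dimensional privacy profile as a function of the distance\<close>

text \<open>Up to an additive constant the distribution function is an integral of a continuous
  density with variable upper limit, so the fundamental theorem of calculus applies.\<close>

lemma std_normal_cdf_has_real_derivative:
  "(std_normal_cdf has_real_derivative std_normal_density t) (at t)"
proof -
  let ?N = "density lborel (\<lambda>y. ennreal (std_normal_density y))"
  interpret N: prob_space ?N
    by (rule prob_space_normal_density) simp
  interpret N: finite_borel_measure ?N
    by unfold_locales simp
  have cont: "continuous_on S std_normal_density" for S
    unfolding normal_density_def by (intro continuous_intros) auto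
  \<comment> \<open>The base point \<open>t - 1\<close> only has to lie below \<open>t\<close>, so
    that \<open>t\<close> is interior to the region on which the identity holds.\<close>
  have eq: "std_normal_cdf s = std_normal_cdf (t - 1) + integral {t - 1..s} std_normal_density"
    if "s \<in> {t - 1<..}" for s
  proof -
    have "std_normal_cdf s - std_normal_cdf (t - 1) = measure ?N {t - 1<..s}"
      unfolding std_normal_cdf_def using that by (intro N.cdf_diff_eq) auto
    also have "\<dots> = (\<integral>y. indicator {t - 1<..s} y \<partial>?N)"
      by simp
    also have "\<dots> = (LINT y:{t - 1<..s}|lborel. std_normal_density y)"
      by (subst integral_real_density) (auto simp: set_lebesgue_integral_def mult.commute)
    also have "\<dots> = integral {t - 1..s} std_normal_density"
      using that
      by (subst interval_integral_Ioc[symmetric], simp,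
          intro interval_integral_eq_integral borel_integrable_atLeastAtMost' cont) auto
    finally show ?thesis by simp
  qed
  have "((\<lambda>s. integral {t - 1..s} std_normal_density) has_real_derivative std_normal_density t)
      (at t within {t - 1..t + 1})"
    by (rule integral_has_real_derivative) (auto intro: cont)
  then have "((\<lambda>s. integral {t - 1..s} std_normal_density) has_real_derivative std_normal_density t) (at t)"
    by (simp add: at_within_Icc_at)
  then have "((\<lambda>s. std_normal_cdf (t - 1) + integral {t - 1..s} std_normal_density)
      has_real_derivative std_normal_density t) (at t)"
    by (auto intro!: derivative_eq_intros)
  then show ?thesis
    by (rule has_field_derivative_transform_within_open[where S="{t - 1<..}"]) (auto simp: eq)
qed

text \<open>For \<open>s > 0\<close> this is the hockey-stick divergence of order
  \<open>exp \<epsilon>\<close> between two isotropic Gaussians whose means are \<open>s\<close>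
  apart. At \<open>s = 0\<close> the convention \<open>x / 0 = 0\<close> yields a value without this
  meaning, so distance zero is always treated separately.\<close>

definition gaussian_privacy_profile :: "real \<Rightarrow> real \<Rightarrow> real \<Rightarrow> real" where
  "gaussian_privacy_profile \<sigma> \<epsilon> s =
     std_normal_cdf (s / (2 * \<sigma>) - \<epsilon> * \<sigma> / s)
       - exp \<epsilon> * std_normal_cdf (- s / (2 * \<sigma>) - \<epsilon> * \<sigma> / s)"

text \<open>The two arguments of the distribution function have squares differing by
  \<open>2 * \<epsilon>\<close>, so the factor \<open>exp \<epsilon>\<close> turns one density value
  into the other. The chain rule terms with \<open>\<epsilon> * \<sigma> / s\<^sup>2\<close> then
  cancel and the two halves \<open>1 / (2 * \<sigma>)\<close> add up. The derivative is positive,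
  which gives monotonicity.\<close>

lemma gaussian_privacy_profile_has_real_derivative:
  assumes "\<sigma> > 0" "s > 0"
  shows "(gaussian_privacy_profile \<sigma> \<epsilon> has_real_derivative
    std_normal_density (s / (2 * \<sigma>) - \<epsilon> * \<sigma> / s) / \<sigma>) (at s)"
proof -
  let ?a = "\<lambda>s. s / (2 * \<sigma>) - \<epsilon> * \<sigma> / s" and ?b = "\<lambda>s. - s / (2 * \<sigma>) - \<epsilon> * \<sigma> / s"
  have "(?b s)\<^sup>2 = (?a s)\<^sup>2 + 2 * \<epsilon>"
    using assms by (simp add: field_simps power2_eq_square)
  then have *: "exp \<epsilon> * std_normal_density (?b s) = std_normal_density (?a s)"
    by (simp add: std_normal_density_def exp_add[symmetric] add_divide_distrib diff_divide_distrib)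
  have a: "(?a has_real_derivative 1 / (2 * \<sigma>) + \<epsilon> * \<sigma> / s\<^sup>2) (at s)"
    using assms by (auto intro!: derivative_eq_intros simp: power2_eq_square)
  have b: "(?b has_real_derivative - 1 / (2 * \<sigma>) + \<epsilon> * \<sigma> / s\<^sup>2) (at s)"
    using assms by (auto intro!: derivative_eq_intros simp: power2_eq_square)
  have "(gaussian_privacy_profile \<sigma> \<epsilon> has_real_derivative
      std_normal_density (?a s) * (1 / (2 * \<sigma>) + \<epsilon> * \<sigma> / s\<^sup>2)
      - exp \<epsilon> * (std_normal_density (?b s) * (- 1 / (2 * \<sigma>) + \<epsilon> * \<sigma> / s\<^sup>2))) (at s)"
    unfolding gaussian_privacy_profile_def[abs_def]
    by (intro DERIV_diff DERIV_cmult
        DERIV_chain2[OF std_normal_cdf_has_real_derivative a]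
        DERIV_chain2[OF std_normal_cdf_has_real_derivative b])
  moreover have "std_normal_density (?a s) * (1 / (2 * \<sigma>) + \<epsilon> * \<sigma> / s\<^sup>2)
      - exp \<epsilon> * (std_normal_density (?b s) * (- 1 / (2 * \<sigma>) + \<epsilon> * \<sigma> / s\<^sup>2))
      = std_normal_density (?a s) / \<sigma>"
    unfolding mult.assoc[symmetric] * by (simp add: algebra_simps)
  ultimately show ?thesis by simp
qed

lemma gaussian_privacy_profile_mono:
  assumes "\<sigma> > 0" "0 < s" "s \<le> t"
  shows "gaussian_privacy_profile \<sigma> \<epsilon> s \<le> gaussian_privacy_profile \<sigma> \<epsilon> t"
proof (rule DERIV_nonneg_imp_nondecreasing[OF assms(3)])
  fix x assume "s \<le> x" "x \<le> t"
  then show "\<exists>y. (gaussian_privacy_profile \<sigma> \<epsilon> has_real_derivative y) (at x) \<and> 0 \<le> y"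
    using assms gaussian_privacy_profile_has_real_derivative[of \<sigma> x \<epsilon>]
    by (intro exI[of _ "std_normal_density (x / (2 * \<sigma>) - \<epsilon> * \<sigma> / x) / \<sigma>"]) auto
qed

section \<open>One-dimensional projections of the isotropic normal law\<close>

lemma isotropic_normal_density_nonneg [simp]: "0 \<le> isotropic_normal_density \<sigma> z"
  by (simp add: isotropic_normal_density_def)

lemma borel_measurable_isotropic_normal_density [measurable]:
  "isotropic_normal_density \<sigma> \<in> borel_measurable borel"
  unfolding isotropic_normal_density_def[abs_def] by measurable

text \<open>The squared norm is the sum of the squared coordinates, so the exponential splits. This
  factorisation is the source of the independence of the coordinates.\<close>

lemma isotropic_normal_density_eq_prod:
  fixes z :: "real ^ 'd"
  shows "isotropic_normal_density \<sigma> z = (\<Prod>b\<in>Basis. normal_density 0 \<sigma> (z \<bullet> b))"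
proof -
  have "(norm z)\<^sup>2 = (\<Sum>b\<in>Basis. (z \<bullet> b)\<^sup>2)"
    unfolding power2_norm_eq_inner by (subst euclidean_inner) (simp add: power2_eq_square)
  then show ?thesis
    by (simp add: isotropic_normal_density_def normal_density_def prod.distrib exp_sum[symmetric]
        prod_dividef power_one_over sum_negf sum_divide_distrib)
qed

context prob_space
begin

context
  fixes Z :: "'a \<Rightarrow> real ^ 'd" and \<sigma> :: real
  assumes \<sigma>: "\<sigma> > 0"
    and Z: "distributed M lborel Z (\<lambda>z. ennreal (isotropic_normal_density \<sigma> z))"
begin

lemma measurable_isotropic_normal [measurable]: "Z \<in> borel_measurable M"
  using distributed_measurable[OF Z] by simp

text \<open>Both density and indicator of a box are products over the coordinates, so the integral
  factorises. Marginals and independence of the coordinates are both read off from this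
  formula.\<close>

lemma emeasure_isotropic_normal_box:
  assumes [measurable]: "\<And>b. b \<in> Basis \<Longrightarrow> A b \<in> sets borel"
  shows "emeasure M {\<omega> \<in> space M. \<forall>b\<in>Basis. Z \<omega> \<bullet> b \<in> A b} =
    (\<Prod>b\<in>Basis. emeasure (density lborel (normal_density 0 \<sigma>)) (A b))"
proof -
  let ?S = "{z. \<forall>b\<in>Basis. z \<bullet> b \<in> A b}"
  let ?f = "\<lambda>b x. ennreal (normal_density 0 \<sigma> x) * indicator (A b) x"
  have [measurable]: "?S \<in> sets borel"
    by measurable
  have "{\<omega> \<in> space M. \<forall>b\<in>Basis. Z \<omega> \<bullet> b \<in> A b} = Z -` ?S \<inter> space M"
    by auto
  then have "emeasure M {\<omega> \<in> space M. \<forall>b\<in>Basis. Z \<omega> \<bullet> b \<in> A b} =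
      (\<integral>\<^sup>+z. ennreal (isotropic_normal_density \<sigma> z) * indicator ?S z \<partial>lborel)"
    using distributed_emeasure[OF Z, of ?S] by simp
  also have "\<dots> = (\<integral>\<^sup>+z. (\<Prod>b\<in>Basis. ?f b (z \<bullet> b)) \<partial>lborel)"
  proof (rule nn_integral_cong)
    fix z :: "real ^ 'd"
    have "indicator ?S z = (\<Prod>b\<in>Basis. indicator (A b) (z \<bullet> b) :: ennreal)"
      by (auto simp: indicator_def prod_zero_iff)
    then show "ennreal (isotropic_normal_density \<sigma> z) * indicator ?S z = (\<Prod>b\<in>Basis. ?f b (z \<bullet> b))"
      by (simp add: isotropic_normal_density_eq_prod prod_ennreal[symmetric] prod.distrib)
  qed
  also have "\<dots> = (\<Prod>b\<in>Basis. \<integral>\<^sup>+x. ?f b x \<partial>lborel)"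
    by (rule nn_integral_lborel_prod) auto
  also have "\<dots> = (\<Prod>b\<in>Basis. emeasure (density lborel (normal_density 0 \<sigma>)) (A b))"
    by (intro prod.cong refl) (simp add: emeasure_density)
  finally show ?thesis .
qed

text \<open>Apply the box formula to a box that constrains the coordinate \<open>b\<close> alone:
  every other factor is the total mass \<open>1\<close>.\<close>

lemma distributed_isotropic_normal_component:
  assumes b: "b \<in> Basis"
  shows "distributed M lborel (\<lambda>\<omega>. Z \<omega> \<bullet> b) (normal_density 0 \<sigma>)"
  unfolding distributed_def
proof (intro conjI measure_eqI)
  fix A assume "A \<in> sets (distr M lborel (\<lambda>\<omega>. Z \<omega> \<bullet> b))"
  then have [measurable]: "A \<in> sets borel" by simp
  interpret N: prob_space "density lborel (normal_density 0 \<sigma>)"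
    by (rule prob_space_normal_density[OF \<sigma>])
  let ?N = "density lborel (normal_density 0 \<sigma>)"
  let ?A = "\<lambda>b'. if b' = b then A else UNIV"
  have "emeasure (distr M lborel (\<lambda>\<omega>. Z \<omega> \<bullet> b)) A
      = emeasure M {\<omega> \<in> space M. \<forall>b'\<in>Basis. Z \<omega> \<bullet> b' \<in> ?A b'}"
    using b by (subst emeasure_distr) (auto intro!: arg_cong[where f="emeasure M"])
  also have "\<dots> = (\<Prod>b'\<in>Basis. emeasure ?N (?A b'))"
    by (rule emeasure_isotropic_normal_box) auto
  also have "\<dots> = (\<Prod>b'\<in>Basis. if b' = b then emeasure ?N A else 1)"
    using N.emeasure_space_1 by (intro prod.cong) auto
  also have "\<dots> = emeasure ?N A"
    using b by simp
  finally show "emeasure (distr M lborel (\<lambda>\<omega>. Z \<omega> \<bullet> b)) A = emeasure ?N A" .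
qed auto

lemma indep_vars_isotropic_normal_components:
  "indep_vars (\<lambda>_. borel) (\<lambda>b \<omega>. Z \<omega> \<bullet> b) Basis"
  unfolding indep_vars_def2
proof (intro conjI ballI)
  let ?F = "\<lambda>b. {(\<lambda>\<omega>. Z \<omega> \<bullet> b) -` A \<inter> space M |A. A \<in> sets borel}"
  show "indep_sets ?F Basis"
  \<comment> \<open>Each family contains the whole space, as the preimage of \<open>UNIV\<close>, so
    the product formula need only be checked over the full index set \<open>Basis\<close> and not
    over its subsets.\<close>
  proof (subst indep_sets_finite; (intro ballI)?)
    fix B assume "B \<in> Pi Basis ?F"
    then have "\<forall>b\<in>Basis. \<exists>A. B b = (\<lambda>\<omega>. Z \<omega> \<bullet> b) -` A \<inter> space M \<and> A \<in> sets borel"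
      by (auto simp: Pi_iff)
    then obtain A where A: "\<And>b. b \<in> Basis \<Longrightarrow> B b = (\<lambda>\<omega>. Z \<omega> \<bullet> b) -` A b \<inter> space M"
        "\<And>b. b \<in> Basis \<Longrightarrow> A b \<in> sets borel"
      by metis
    let ?N = "density lborel (normal_density 0 \<sigma>)"
    have B: "emeasure M (B b) = emeasure ?N (A b)" if "b \<in> Basis" for b
      using distributed_distr_eq_density[OF distributed_isotropic_normal_component[OF that]] A[OF that]
        emeasure_distr[of "\<lambda>\<omega>. Z \<omega> \<bullet> b" M lborel "A b"]
      by simp
    have "(\<Inter>b\<in>Basis. B b) = {\<omega> \<in> space M. \<forall>b\<in>Basis. Z \<omega> \<bullet> b \<in> A b}"
      using A(1) by auto
    then have "emeasure M (\<Inter>b\<in>Basis. B b) = (\<Prod>b\<in>Basis. emeasure M (B b))"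
      using emeasure_isotropic_normal_box[OF A(2)] B by simp
    then show "prob (\<Inter>b\<in>Basis. B b) = (\<Prod>b\<in>Basis. prob (B b))"
      by (simp add: emeasure_eq_measure prod_ennreal prod_nonneg)
  qed (auto intro!: exI[of _ UNIV])
qed auto

text \<open>This is the rotation invariance of the law: the inner product is a sum of independent
  centred normals with variances \<open>(u \<bullet> b)\<^sup>2 * \<sigma>\<^sup>2\<close>, which
  add up to \<open>\<sigma>\<^sup>2\<close> for a unit vector.\<close>

lemma distributed_isotropic_normal_inner:
  assumes u: "norm u = 1"
  shows "distributed M lborel (\<lambda>\<omega>. Z \<omega> \<bullet> u) (normal_density 0 \<sigma>)"
proof -
  \<comment> \<open>The rule for sums of independent normals demands positive standard deviations
    and a nonempty index set, so vanishing coordinates of \<open>u\<close> are dropped.\<close>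
  define I where "I = {b \<in> Basis. u \<bullet> b \<noteq> 0}"
  have "u \<noteq> 0"
    using u by auto
  then have I: "finite I" "I \<noteq> {}" "I \<subseteq> Basis"
    unfolding I_def using euclidean_all_zero_iff[of u] by auto
  have "distributed M lborel (\<lambda>\<omega>. \<Sum>b\<in>I. u \<bullet> b * (Z \<omega> \<bullet> b))
      (normal_density (\<Sum>b\<in>I. 0) (sqrt (\<Sum>b\<in>I. (\<bar>u \<bullet> b\<bar> * \<sigma>)\<^sup>2)))"
  proof (rule sum_indep_normal[OF I(1,2)])
    show "indep_vars (\<lambda>_. borel) (\<lambda>b \<omega>. u \<bullet> b * (Z \<omega> \<bullet> b)) I"
      by (rule indep_vars_compose2[OF
            indep_vars_subset[OF indep_vars_isotropic_normal_components I(3)]]) simp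
    fix b assume b: "b \<in> I"
    then show "0 < \<bar>u \<bullet> b\<bar> * \<sigma>"
      using \<sigma> by (simp add: I_def)
    show "distributed M lborel (\<lambda>\<omega>. u \<bullet> b * (Z \<omega> \<bullet> b)) (normal_density 0 (\<bar>u \<bullet> b\<bar> * \<sigma>))"
      using normal_density_affine[OF distributed_isotropic_normal_component \<sigma>, of b "u \<bullet> b" 0] b
      by (simp add: I_def)
  qed
  moreover have "(\<Sum>b\<in>I. u \<bullet> b * (z \<bullet> b)) = z \<bullet> u" for z
  proof -
    have "(\<Sum>b\<in>I. u \<bullet> b * (z \<bullet> b)) = (\<Sum>b\<in>Basis. u \<bullet> b * (z \<bullet> b))"
      by (rule sum.mono_neutral_left) (auto simp: I_def)
    then show ?thesis
      by (subst euclidean_inner) (simp add: mult.commute)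
  qed
  moreover from this[of u] have "(\<Sum>b\<in>I. (\<bar>u \<bullet> b\<bar> * \<sigma>)\<^sup>2) = \<sigma>\<^sup>2"
    using u by (simp add: power_mult_distrib sum_distrib_right[symmetric] norm_eq_1
        flip: power2_eq_square)
  ultimately show ?thesis
    using \<sigma> by simp
qed

lemma prob_isotropic_normal_halfspace:
  assumes "norm u = 1"
  shows "prob {\<omega> \<in> space M. Z \<omega> \<bullet> u \<le> \<sigma> * t} = std_normal_cdf t"
proof -
  have d: "distributed M lborel (\<lambda>\<omega>. Z \<omega> \<bullet> u / \<sigma>) std_normal_density"
    using distributed_isotropic_normal_inner[OF assms] normal_standard_normal_convert[OF \<sigma>, of _ 0]
    by simp
  have "{\<omega> \<in> space M. Z \<omega> \<bullet> u \<le> \<sigma> * t} = (\<lambda>\<omega>. Z \<omega> \<bullet> u / \<sigma>) -` {..t} \<inter> space M"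
    using \<sigma> by (auto simp: field_simps)
  then show ?thesis
    using distributed_distr_eq_density[OF d] measure_distr[OF distributed_measurable[OF d], of "{..t}"]
    by (simp add: std_normal_cdf_def cdf_def)
qed

lemma integrable_isotropic_normal_density:
  "integrable lborel (\<lambda>y. isotropic_normal_density \<sigma> (y - c :: real ^ 'd))"
proof -
  \<comment> \<open>Integrability of the density is that of the constant \<open>1\<close> under
    \<open>P\<close>'s counterpart \<open>M\<close>; translation invariance of Lebesgue measure then
    moves the centre to \<open>c\<close>.\<close>
  have "integrable lborel (isotropic_normal_density \<sigma> :: real ^ 'd \<Rightarrow> real)"
    using distributed_integrable[OF Z, of "\<lambda>_. 1 :: real"] by simp
  then have "integrable (distr lborel borel ((+) (- c))) (isotropic_normal_density \<sigma> :: real ^ 'd \<Rightarrow> real)"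
    by (simp only: lborel_distr_plus)
  then show ?thesis
    by (subst (asm) integrable_distr_eq) simp_all
qed

lemma prob_isotropic_normal_shift:
  assumes [measurable]: "E \<in> sets borel"
  shows "prob {\<omega> \<in> space M. c + Z \<omega> \<in> E} = (LINT y:E|lborel. isotropic_normal_density \<sigma> (y - c))"
proof -
  let ?g = "\<lambda>y. isotropic_normal_density \<sigma> (y - c) * indicator E y :: real"
  have "prob {\<omega> \<in> space M. c + Z \<omega> \<in> E} = (\<integral>\<omega>. indicator {\<omega> \<in> space M. c + Z \<omega> \<in> E} \<omega> \<partial>M)"
    by simp
  also have "\<dots> = (\<integral>\<omega>. indicator E (c + Z \<omega>) \<partial>M)"
    by (rule Bochner_Integration.integral_cong) (auto simp: indicator_def)
  also have "\<dots> = (\<integral>z. isotropic_normal_density \<sigma> z * indicator E (c + z) \<partial>lborel)"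
    by (rule distributed_integral[OF Z, symmetric]) auto
  also have "\<dots> = (\<integral>z. ?g (c + z) \<partial>lborel)"
    by simp
  also have "\<dots> = (\<integral>y. ?g y \<partial>distr lborel borel ((+) c))"
    by (rule integral_distr[symmetric]) simp_all
  finally show ?thesis
    by (simp add: lborel_distr_plus set_lebesgue_integral_def mult.commute)
qed

section \<open>The extremal half-space for a pair of shifted Gaussians\<close>

lemma gaussian_hockey_stick:
  fixes x x' :: "real ^ 'd" and \<epsilon> :: real
  assumes "x \<noteq> x'"
  defines "s \<equiv> norm (x - x')"
  defines "H \<equiv> {y. (y - x) \<bullet> ((x' - x) /\<^sub>R s) \<le> \<sigma> * (s / (2 * \<sigma>) - \<epsilon> * \<sigma> / s)}"
  shows gaussian_hockey_stick_halfspace: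
      "prob {\<omega> \<in> space M. x + Z \<omega> \<in> H} - exp \<epsilon> * prob {\<omega> \<in> space M. x' + Z \<omega> \<in> H} =
        gaussian_privacy_profile \<sigma> \<epsilon> s"
    and gaussian_hockey_stick_le:
      "E \<in> sets borel \<Longrightarrow>
        prob {\<omega> \<in> space M. x + Z \<omega> \<in> E} - exp \<epsilon> * prob {\<omega> \<in> space M. x' + Z \<omega> \<in> E} \<le>
        gaussian_privacy_profile \<sigma> \<epsilon> s"
proof -
  define u where "u = (x' - x) /\<^sub>R s"
  have s: "s > 0" and x': "x' = x + s *\<^sub>R u"
    using assms(1) by (simp_all add: s_def u_def)
  have u: "norm u = 1"
    using s by (simp add: u_def s_def norm_minus_commute)
  have H: "H = {y. (y - x) \<bullet> u \<le> \<sigma> * (s / (2 * \<sigma>) - \<epsilon> * \<sigma> / s)}"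
    by (simp add: H_def u_def)
  have [measurable]: "H \<in> sets borel"
    unfolding H by measurable
  have "u \<bullet> u = 1"
    using u by (simp add: norm_eq_1)
  \<comment> \<open>Moving the centre from \<open>x\<close> to \<open>x'\<close> lowers the
    threshold by \<open>s\<close>, which just flips the sign of
    \<open>s / (2 * \<sigma>)\<close>.\<close>
  then have "x' + z \<in> H \<longleftrightarrow> z \<bullet> u \<le> \<sigma> * (- s / (2 * \<sigma>) - \<epsilon> * \<sigma> / s)" for z
    using \<sigma> by (auto simp: H x' inner_simps right_diff_distrib)
  moreover have "x + z \<in> H \<longleftrightarrow> z \<bullet> u \<le> \<sigma> * (s / (2 * \<sigma>) - \<epsilon> * \<sigma> / s)" for z
    by (simp add: H)
  ultimately show *: "prob {\<omega> \<in> space M. x + Z \<omega> \<in> H} - exp \<epsilon> * prob {\<omega> \<in> space M. x' + Z \<omega> \<in> H} =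
      gaussian_privacy_profile \<sigma> \<epsilon> s"
    by (simp only: prob_isotropic_normal_halfspace[OF u] gaussian_privacy_profile_def)
  \<comment> \<open>The integral of \<open>h\<close> over an event is the difference of
    probabilities to be maximised, so the best event is the set where \<open>h\<close> is
    nonnegative.\<close>
  define h where "h y = isotropic_normal_density \<sigma> (y - x) - exp \<epsilon> * isotropic_normal_density \<sigma> (y - x')" for y
  have h: "0 \<le> h y \<longleftrightarrow> y \<in> H" for y
  proof -
    \<comment> \<open>Because both Gaussians have the same covariance, the quadratic terms in
      \<open>y\<close> cancel in the comparison of exponents; the remaining condition is linear and
      describes \<open>H\<close>.\<close>
    have "(norm (y - x'))\<^sup>2 = (norm (y - x))\<^sup>2 - 2 * s * ((y - x) \<bullet> u) + s\<^sup>2"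
      unfolding power2_norm_eq_inner x' using \<open>u \<bullet> u = 1\<close>
      by (simp add: inner_simps inner_commute algebra_simps power2_eq_square)
    moreover have "0 \<le> h y \<longleftrightarrow> 2 * \<epsilon> * \<sigma>\<^sup>2 + (norm (y - x))\<^sup>2 \<le> (norm (y - x'))\<^sup>2"
    proof -
      have "h y = 1 / sqrt (2 * pi * \<sigma>\<^sup>2) ^ CARD('d) *
          (exp (- (norm (y - x))\<^sup>2 / (2 * \<sigma>\<^sup>2)) - exp (\<epsilon> + - (norm (y - x'))\<^sup>2 / (2 * \<sigma>\<^sup>2)))"
        by (simp only: h_def isotropic_normal_density_def exp_add) (simp add: algebra_simps)
      moreover have "1 / sqrt (2 * pi * \<sigma>\<^sup>2) ^ CARD('d) > 0"
        using \<sigma> by simp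
      ultimately have "0 \<le> h y \<longleftrightarrow>
          \<epsilon> + - (norm (y - x'))\<^sup>2 / (2 * \<sigma>\<^sup>2) \<le> - (norm (y - x))\<^sup>2 / (2 * \<sigma>\<^sup>2)"
        by (simp only: zero_le_mult_iff) (simp add: not_le)
      also have "\<epsilon> + - (norm (y - x'))\<^sup>2 / (2 * \<sigma>\<^sup>2) =
          (2 * \<epsilon> * \<sigma>\<^sup>2 - (norm (y - x'))\<^sup>2) / (2 * \<sigma>\<^sup>2)"
        using \<sigma> by (simp add: field_simps)
      also have "\<dots> \<le> - (norm (y - x))\<^sup>2 / (2 * \<sigma>\<^sup>2) \<longleftrightarrow>
          2 * \<epsilon> * \<sigma>\<^sup>2 - (norm (y - x'))\<^sup>2 \<le> - (norm (y - x))\<^sup>2"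
        using \<sigma> by (subst divide_le_cancel) auto
      finally show ?thesis
        by auto
    qed
    moreover have "y \<in> H \<longleftrightarrow> 2 * s * ((y - x) \<bullet> u) \<le> s\<^sup>2 - 2 * \<epsilon> * \<sigma>\<^sup>2"
    proof -
      have "\<sigma> * (s / (2 * \<sigma>) - \<epsilon> * \<sigma> / s) = (s\<^sup>2 - 2 * \<epsilon> * \<sigma>\<^sup>2) / (2 * s)"
        using \<sigma> s by (simp add: field_simps power2_eq_square)
      then show ?thesis
        unfolding H mem_Collect_eq using s by (simp add: pos_le_divide_eq mult.commute)
    qed
    ultimately show ?thesis
      by auto
  qed
  have int: "integrable lborel h"
    unfolding h_def by (intro Bochner_Integration.integrable_diff integrable_mult_right
        integrable_isotropic_normal_density)
  have diff: "prob {\<omega> \<in> space M. x + Z \<omega> \<in> A} - exp \<epsilon> * prob {\<omega> \<in> space M. x' + Z \<omega> \<in> A} =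
      (LINT y:A|lborel. h y)" if [measurable]: "A \<in> sets borel" for A
  proof -
    have "set_integrable lborel A (\<lambda>y. isotropic_normal_density \<sigma> (y - c))" for c :: "real ^ 'd"
      unfolding set_integrable_def
      by (intro integrable_mult_indicator integrable_isotropic_normal_density) simp
    then show ?thesis
      unfolding h_def by (simp add: prob_isotropic_normal_shift set_integral_diff)
  qed
  assume [measurable]: "E \<in> sets borel"
  \<comment> \<open>Passing from \<open>E\<close> to \<open>H\<close> drops only points with
    \<open>h\<close> negative and adds only points with \<open>h\<close> nonnegative.\<close>
  have "(LINT y:E|lborel. h y) \<le> (LINT y:H|lborel. h y)"
    unfolding set_lebesgue_integral_def
  proof (intro integral_mono integrable_mult_indicator int)
    show "indicator E y *\<^sub>R h y \<le> indicator H y *\<^sub>R h y" for y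
      using h[of y] by (auto simp: indicator_def)
  qed simp_all
  then show "prob {\<omega> \<in> space M. x + Z \<omega> \<in> E} - exp \<epsilon> * prob {\<omega> \<in> space M. x' + Z \<omega> \<in> E} \<le>
      gaussian_privacy_profile \<sigma> \<epsilon> s"
    using * by (simp add: diff)
qed

text \<open>The half-space attains the bound valid for all events, so testing the inequality on it
  alone already decides it for every event.\<close>

lemma gaussian_hockey_stick_le_iff:
  fixes x x' :: "real ^ 'd"
  assumes "x \<noteq> x'"
  shows "(\<forall>E\<in>sets borel. prob {\<omega> \<in> space M. x + Z \<omega> \<in> E}
      \<le> exp \<epsilon> * prob {\<omega> \<in> space M. x' + Z \<omega> \<in> E} + \<delta>) \<longleftrightarrow>
    gaussian_privacy_profile \<sigma> \<epsilon> (norm (x - x')) \<le> \<delta>"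
proof
  let ?H = "{y. (y - x) \<bullet> ((x' - x) /\<^sub>R norm (x - x')) \<le>
    \<sigma> * (norm (x - x') / (2 * \<sigma>) - \<epsilon> * \<sigma> / norm (x - x'))}"
  assume *: "\<forall>E\<in>sets borel. prob {\<omega> \<in> space M. x + Z \<omega> \<in> E}
      \<le> exp \<epsilon> * prob {\<omega> \<in> space M. x' + Z \<omega> \<in> E} + \<delta>"
  have "?H \<in> sets borel"
    by measurable
  from bspec[OF * this] gaussian_hockey_stick_halfspace[OF assms, of \<epsilon>]
  show "gaussian_privacy_profile \<sigma> \<epsilon> (norm (x - x')) \<le> \<delta>"
    by linarith
next
  assume "gaussian_privacy_profile \<sigma> \<epsilon> (norm (x - x')) \<le> \<delta>"
  then show "\<forall>E\<in>sets borel. prob {\<omega> \<in> space M. x + Z \<omega> \<in> E}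
      \<le> exp \<epsilon> * prob {\<omega> \<in> space M. x' + Z \<omega> \<in> E} + \<delta>"
    using gaussian_hockey_stick_le[OF assms, of _ \<epsilon>] by fastforce
qed

end

end

section \<open>From pairs of inputs to the global sensitivity\<close>

theorem theorem8:
  fixes X :: "'x set" and nb :: "'x \<Rightarrow> 'x \<Rightarrow> bool"
    and f :: "'x \<Rightarrow> real ^ 'd" and \<Delta> \<sigma> \<epsilon> \<delta> :: real
    and P :: "'w measure" and Z :: "'w \<Rightarrow> real ^ 'd"
  assumes "symp_on X nb"
    and "L2_sensitivity X nb f = ennreal \<Delta>" and "\<Delta> > 0"
    and "\<sigma> > 0"
    and "\<epsilon> \<ge> 0" and "0 \<le> \<delta>" and "\<delta> \<le> 1"
    and "prob_space P"
    and "distributed P lborel Z (\<lambda>z. ennreal (isotropic_normal_density \<sigma> z))"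
  shows "differentially_private P X nb borel \<epsilon> \<delta> (\<lambda>x \<omega>. f x + Z \<omega>) \<longleftrightarrow>
    std_normal_cdf (\<Delta> / (2 * \<sigma>) - \<epsilon> * \<sigma> / \<Delta>)
      - exp \<epsilon> * std_normal_cdf (- \<Delta> / (2 * \<sigma>) - \<epsilon> * \<sigma> / \<Delta>) \<le> \<delta>"
proof -
  note \<Delta> = assms(2,3) and \<sigma> = assms(4) and Z = assms(9)
  interpret prob_space P by fact
  let ?N = "neighbour_pairs X nb" and ?G = "gaussian_privacy_profile \<sigma> \<epsilon>"
  let ?n = "\<lambda>(x, x'). norm (f x - f x')"
  have Sup: "(SUP p\<in>?N. ennreal (?n p)) = ennreal \<Delta>"
    using \<Delta>(1) by (simp add: L2_sensitivity_def case_prod_unfold)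
  have "ennreal (?n p) \<le> ennreal \<Delta>" if "p \<in> ?N" for p
    using SUP_upper[OF that, of "\<lambda>p. ennreal (?n p)"] Sup by simp
  then have le: "?n p \<le> \<Delta>" if "p \<in> ?N" for p
    using that \<Delta>(2) by (fastforce simp: ennreal_le_iff)
  \<comment> \<open>The supremum may not be attained, so only distances exceeding a given
    \<open>r < \<Delta>\<close> are available.\<close>
  have ex: "\<exists>p\<in>?N. r < ?n p" if "0 \<le> r" "r < \<Delta>" for r
  proof -
    have "ennreal r < (SUP p\<in>?N. ennreal (?n p))"
      unfolding Sup using that by (simp add: ennreal_lessI)
    then show ?thesis
      using that unfolding less_SUP_iff by (auto simp: ennreal_less_iff)
  qed
  have [measurable]: "Z \<in> borel_measurable P"
    using distributed_measurable[OF Z] by simp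
  have "differentially_private P X nb borel \<epsilon> \<delta> (\<lambda>x \<omega>. f x + Z \<omega>) \<longleftrightarrow>
      (\<forall>(x, x')\<in>?N. \<forall>E\<in>sets borel. prob {\<omega> \<in> space P. f x + Z \<omega> \<in> E}
        \<le> exp \<epsilon> * prob {\<omega> \<in> space P. f x' + Z \<omega> \<in> E} + \<delta>)"
    using assms(8) by (simp add: differentially_private_def randomized_algorithm_def)
  also have "\<dots> \<longleftrightarrow> (\<forall>p\<in>?N. ?n p > 0 \<longrightarrow> ?G (?n p) \<le> \<delta>)"
  proof (intro ball_cong refl)
    fix p :: "'x \<times> 'x"
    obtain x x' where p: "p = (x, x')"
      by (cases p)
    \<comment> \<open>This settles pairs with \<open>f x = f x'\<close>, whose outputs have the same
      law: \<open>exp \<epsilon> \<ge> 1\<close> and \<open>\<delta> \<ge> 0\<close> give the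
      inequality, and the condition on the profile is restricted to positive distances.\<close>
    have "prob A \<le> exp \<epsilon> * prob A + \<delta>" for A
      using assms(5,6) mult_right_mono[of 1 "exp \<epsilon>" "prob A"] by simp
    then show "(case p of (x, x') \<Rightarrow> \<forall>E\<in>sets borel. prob {\<omega> \<in> space P. f x + Z \<omega> \<in> E}
        \<le> exp \<epsilon> * prob {\<omega> \<in> space P. f x' + Z \<omega> \<in> E} + \<delta>) \<longleftrightarrow>
      (?n p > 0 \<longrightarrow> ?G (?n p) \<le> \<delta>)"
      using gaussian_hockey_stick_le_iff[OF \<sigma> Z, of "f x" "f x'" \<epsilon> \<delta>]
      by (cases "f x = f x'") (simp_all add: p)
  qed
  also have "\<dots> \<longleftrightarrow> ?G \<Delta> \<le> \<delta>"
  proof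
    assume *: "\<forall>p\<in>?N. ?n p > 0 \<longrightarrow> ?G (?n p) \<le> \<delta>"
    \<comment> \<open>Some pair lies further apart than \<open>r\<close>, so monotonicity carries
      its bound down to \<open>r\<close>; letting \<open>r\<close> tend to \<open>\<Delta>\<close>
      from the left then uses continuity of the profile.\<close>
    have "?G r \<le> \<delta>" if "0 < r" "r < \<Delta>" for r
      using ex[of r] * gaussian_privacy_profile_mono[OF \<sigma> that(1), of _ \<epsilon>] that
      by (meson less_imp_le less_trans order_trans)
    then have "eventually (\<lambda>r. ?G r \<le> \<delta>) (at_left \<Delta>)"
      using eventually_at_left_real[OF \<Delta>(2)] by (auto elim!: eventually_mono)
    moreover have "(?G \<longlongrightarrow> ?G \<Delta>) (at_left \<Delta>)"
      using DERIV_isCont[OF gaussian_privacy_profile_has_real_derivative[OF \<sigma> \<Delta>(2)]]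
      by (simp add: isCont_def filterlim_at_split)
    ultimately show "?G \<Delta> \<le> \<delta>"
      by (intro tendsto_upperbound) auto
  next
    assume "?G \<Delta> \<le> \<delta>"
    then show "\<forall>p\<in>?N. ?n p > 0 \<longrightarrow> ?G (?n p) \<le> \<delta>"
      using gaussian_privacy_profile_mono[OF \<sigma> _ le] by (meson order_trans)
  qed
  finally show ?thesis
    by (simp add: gaussian_privacy_profile_def)
qed

end
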